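(* (ZFC) There is a nonmetrizable compact Hausdorff space $K$ such that every closed totally disconnected subspace of $K$ is metrizable. Moreover, there is also such a space $K$ which in addition has a closed subspace $K'\subseteq K$ admitting a continuous surjection onto a nonmetrizable totally disconnected compact space.
   Context: All spaces are Hausdorff. *)

theory Defs
  imports "HOL-Analysis.Analysis"
begin

definition totally_disconnected_space :: "'a topology \<Rightarrow> bool" where
  "totally_disconnected_space X \<longleftrightarrow>
     (\<forall>S. connectedin X S \<longrightarrow> (\<forall>x\<in>S. \<forall>y\<in>S. x = y))"

definition good_space :: "'a topology \<Rightarrow> bool" where
  "good_space K \<longleftrightarrow> compact_space K \<and> Hausdorff_space K \<and> \<not> metrizable_space K \<and>
     (\<forall>S. closedin K S \<and> totally_disconnected_space (subtopology K S)
          \<longrightarrow> metrizable_space (subtopology K S))"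

end

theory Submission
  imports Defs
begin

text \<open>
  Resolve points of the unit interval: \<open>K\<close> consists of all \<open>(x, t)\<close> with \<open>(x, t\<^sub>y) \<in> G\<^sub>y\<close> for all \<open>y\<close>,
  where \<open>G\<^sub>y\<close> is a closed relation that is the graph of a function except over \<open>y\<close>.
  As \<open>K\<close> is closed in a product of intervals, it is compact Hausdorff, and it is not metrizable
  as soon as uncountably many fibres are nontrivial.
  A Bernstein-type recursion gives distinct points \<open>c\<^sub>P \<in> P\<close> for all perfect sets \<open>P\<close>, and a disjoint
  set \<open>A\<close> that meets every perfect set. Over \<open>y = c\<^sub>P\<close>, \<open>G\<^sub>y\<close> is given by a function on the complement of \<open>y\<close> that
  oscillates between 0 and 1 along \<open>P\<close>, so that a closed set whose projection contains \<open>P\<close> contains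
  the whole arc over \<open>c\<^sub>P\<close>. Hence a closed totally disconnected set has countable projection; it then
  embeds in a countable product of intervals. Over \<open>y \<in> A\<close>, \<open>G\<^sub>y\<close> is the jump function at \<open>y\<close>; forgetting all
  coordinates outside \<open>A\<close> maps \<open>K\<close> onto a split interval.
\<close>

section \<open>Perfect sets of reals\<close>

text \<open>Well-order \<open>I\<close> by its cardinal. Every proper initial segment is then
  strictly smaller than \<open>I\<close>, so when stage \<open>i\<close> is reached fewer values
  have been used than \<open>P i\<close> has elements, and a fresh one remains.\<close>

lemma injective_choice_if_lepoll:
  includes cardinal_syntax
  assumes le: "\<And>i. i \<in> I \<Longrightarrow> I \<lesssim> P i"
  obtains c where "inj_on c I" "\<And>i. i \<in> I \<Longrightarrow> c i \<in> P i"
proof -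
  define r where "r = |I|"
  have wo: "Well_order r" and co: "Card_order r" and field: "Field r = I"
    by (simp_all add: r_def card_of_well_order_on card_of_card_order_on Field_card_of)
  have "wf (r - Id)"
    using wo by (simp add: well_order_on_def)
  moreover have "\<exists>v. i \<in> I \<longrightarrow> v \<in> P i \<and> (\<forall>j. (j, i) \<in> r - Id \<longrightarrow> c j \<noteq> v)" for i c
  proof (cases "i \<in> I")
    case True
    have "|c ` underS r i| <o |I|"
      using card_of_underS[OF co, of i] card_of_image[of c "underS r i"] True field
      by (metis ordLeq_ordLess_trans r_def)
    moreover have "|I| \<le>o |P i|"
      using le[OF True] by (simp add: lepoll_def card_of_ordLeq)
    ultimately have "|c ` underS r i| <o |P i|"
      by (rule ordLess_ordLeq_trans)
    then have "\<not> P i \<subseteq> c ` underS r i"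
      using card_of_mono1 not_ordLess_ordLeq by blast
    then show ?thesis
      by (fastforce simp: underS_def)
  qed auto
  ultimately have "\<exists>c. \<forall>i. i \<in> I \<longrightarrow> c i \<in> P i \<and> (\<forall>j. (j, i) \<in> r - Id \<longrightarrow> c j \<noteq> c i)"
    by (intro dependent_wf_choice[where P = "\<lambda>c i v. i \<in> I \<longrightarrow> v \<in> P i \<and> (\<forall>j. (j, i) \<in> r - Id \<longrightarrow> c j \<noteq> v)"])
       auto
  then obtain c where c: "\<And>i. i \<in> I \<Longrightarrow> c i \<in> P i"
      "\<And>i j. i \<in> I \<Longrightarrow> (j, i) \<in> r - Id \<Longrightarrow> c j \<noteq> c i"
    by blast
  have "(i, j) \<in> r \<or> (j, i) \<in> r" if "i \<in> I" "j \<in> I" "i \<noteq> j" for i j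
    using wo that field unfolding well_order_on_def linear_order_on_def total_on_def by blast
  then have "inj_on c I"
    using c(2) by (metis Diff_iff inj_onI pair_in_Id_conv)
  with c(1) show ?thesis
    using that by blast
qed

text \<open>Cantor-Bendixson argument: keep the condensation points of \<open>C\<close>. The
  discarded points are covered by countably many basic open sets, each meeting \<open>C\<close> in a
  countable set, so only countably many points are lost.\<close>

lemma uncountable_closed_contains_perfect:
  fixes C :: "'a::{second_countable_topology, t1_space} set"
  assumes "closed C" "uncountable C"
  obtains P where "closed P" "P \<noteq> {}" "P \<subseteq> C" "\<And>x. x \<in> P \<Longrightarrow> x islimpt P"
proof -
  define P where "P = {x \<in> C. \<forall>U. open U \<and> x \<in> U \<longrightarrow> uncountable (U \<inter> C)}"
  obtain \<B> :: "'a set set" where \<B>: "countable \<B>" "topological_basis \<B>"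
    using ex_countable_basis by blast
  have "C - P \<subseteq> (\<Union>B \<in> {B \<in> \<B>. countable (B \<inter> C)}. B \<inter> C)"
  proof
    fix x assume "x \<in> C - P"
    then obtain U where U: "open U" "x \<in> U" "countable (U \<inter> C)" and "x \<in> C"
      by (auto simp: P_def)
    obtain B where "B \<in> \<B>" "x \<in> B" "B \<subseteq> U"
      using topological_basisE[OF \<B>(2) U(1,2)] .
    with U \<open>x \<in> C\<close> show "x \<in> (\<Union>B \<in> {B \<in> \<B>. countable (B \<inter> C)}. B \<inter> C)"
      by (auto intro: countable_subset[of "B \<inter> C" "U \<inter> C"])
  qed
  moreover have "countable (\<Union>B \<in> {B \<in> \<B>. countable (B \<inter> C)}. B \<inter> C)"
    using \<B>(1) by (intro countable_UN) auto
  ultimately have rest: "countable (C - P)"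
    by (rule countable_subset)
  have "P \<subseteq> C"
    by (auto simp: P_def)
  \<comment> \<open>As \<open>C - P\<close> is countable, an open set meeting \<open>C\<close>
    uncountably still meets \<open>P\<close> uncountably. This yields both nonemptiness and the
    absence of isolated points.\<close>
  have unc: "uncountable (U \<inter> P)" if "open U" "uncountable (U \<inter> C)" for U
  proof
    assume "countable (U \<inter> P)"
    then have "countable (U \<inter> P \<union> (C - P))"
      using rest by auto
    then show False
      using that countable_subset[of "U \<inter> C" "U \<inter> P \<union> (C - P)"] by blast
  qed
  have "P \<noteq> {}"
    using unc[of UNIV] assms(2) by force
  moreover have "x islimpt P" if "x \<in> P" for x
  proof (rule islimptI)
    fix U assume "x \<in> U" "open U"
    then have "uncountable (U \<inter> P)"
      using that unc by (auto simp: P_def)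
    then have "uncountable (U \<inter> P - {x})"
      by (simp add: uncountable_minus_countable)
    then obtain y where "y \<in> U \<inter> P - {x}"
      by (metis all_not_in_conv countable_empty)
    then show "\<exists>y\<in>P. y \<in> U \<and> y \<noteq> x"
      by blast
  qed
  moreover have "closed P"
    unfolding closed_limpt
  proof (intro allI impI)
    fix x assume x: "x islimpt P"
    then have "x \<in> C"
      using assms(1) \<open>P \<subseteq> C\<close> by (meson closed_limpt islimpt_subset)
    moreover have "uncountable (U \<inter> C)" if "open U" "x \<in> U" for U
      using islimptE[OF x that(2,1)] that(1) unfolding P_def by blast
    ultimately show "x \<in> P"
      by (auto simp: P_def)
  qed
  ultimately show ?thesis
    using \<open>P \<subseteq> C\<close> that by blast
qed

text \<open>A closed set is determined by the members of a countable basis that miss it, hence by a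
  set of naturals. This bounds the number of perfect sets by the continuum, the size of each of
  them, as the injective choice requires.\<close>

lemma closed_sets_lepoll_real:
  "{C :: 'a::second_countable_topology set. closed C} \<lesssim> (UNIV :: real set)"
proof -
  obtain \<B> :: "'a set set" where \<B>: "countable \<B>" "topological_basis \<B>"
    using ex_countable_basis by blast
  define code where "code C = to_nat_on \<B> ` {B \<in> \<B>. B \<inter> C = {}}" for C
  have "C \<subseteq> D" if "closed C" "closed D" and eq: "code C = code D" for C D
  proof
    fix x assume "x \<in> C"
    show "x \<in> D"
    proof (rule ccontr)
      assume "x \<notin> D"
      then obtain B where B: "B \<in> \<B>" "x \<in> B" "B \<subseteq> - D"
        using topological_basisE[OF \<B>(2), of "- D" x] \<open>closed D\<close> by auto
      then have "to_nat_on \<B> B \<in> code C"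
        unfolding eq by (auto simp: code_def)
      then have "B \<inter> C = {}"
        using B(1) \<B>(1) by (auto simp: code_def)
      with B \<open>x \<in> C\<close> show False
        by blast
    qed
  qed
  then have "inj_on code {C. closed C}"
    by (metis (mono_tags) inj_onI mem_Collect_eq subset_antisym)
  then have "{C :: 'a set. closed C} \<lesssim> (UNIV :: nat set set)"
    unfolding lepoll_def by blast
  then show ?thesis
    using nat_sets_eqpoll_reals eqpoll_imp_lepoll lepoll_trans by blast
qed

lemma real_lepoll_perfect_set:
  fixes P :: "real set"
  assumes "closed P" "P \<noteq> {}" "\<And>x. x \<in> P \<Longrightarrow> x islimpt P"
  shows "(UNIV :: real set) \<lesssim> P"
proof (rule lepoll_perfect_set[where X = euclideanreal])
  have "euclideanreal derived_set_of P = {x. x islimpt P}"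
    by (auto simp: derived_set_of_def islimpt_def)
  then show "euclideanreal derived_set_of P = P"
    using assms(1,3) by (auto simp: closed_limpt)
qed (auto simp: assms completely_metrizable_space_euclidean)

lemma real_product_lepoll_real: "(UNIV :: (real \<times> real) set) \<lesssim> (UNIV :: real set)"
  using card_of_Times_same_infinite[OF infinite_UNIV_char_0] ordIso_imp_ordLeq
  unfolding lepoll_def UNIV_Times_UNIV[symmetric] card_of_ordLeq by blast

section \<open>Bernstein-type selection from the perfect sets\<close>

definition perfect_sets :: "real set set" where
  "perfect_sets = {P. closed P \<and> P \<noteq> {} \<and> P \<subseteq> {0..1} \<and> (\<forall>x\<in>P. x islimpt P)}"

lemma Icc_in_perfect_sets:
  assumes "0 \<le> a" "a < b" "b \<le> 1"
  shows "{a..b} \<in> perfect_sets"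
proof -
  have "x islimpt {a..b}" if "x \<in> {a..b}" for x
  proof (rule connected_imp_perfect[OF connected_Icc that])
    show "{a..b} \<noteq> {z}" for z
      using assms(2) by (simp add: atLeastAtMost_singleton_iff)
  qed
  then show ?thesis
    using assms by (auto simp: perfect_sets_def)
qed

lemma uncountable_perfect_sets: "uncountable perfect_sets"
proof -
  have "inj_on (\<lambda>e. {0..e}) {0<..1::real}"
    by (auto intro: inj_onI)
  then have "uncountable ((\<lambda>e. {0..e}) ` {0<..1::real})"
    using countable_image_inj_on uncountable_half_open_interval_2[of 0 "1::real"] by auto
  moreover have "(\<lambda>e. {0..e}) ` {0<..1} \<subseteq> perfect_sets"
    using Icc_in_perfect_sets by auto
  ultimately show ?thesis
    using countable_subset by blast
qed

text \<open>Each perfect set enters the injective choice twice, with a boolean tag. The points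
  tagged \<open>True\<close> give \<open>c\<close>, those tagged \<open>False\<close> form
  \<open>A\<close>; injectivity over all tagged sets makes the two families disjoint.\<close>

lemma disjoint_perfect_set_selectors:
  obtains A :: "real set" and c :: "real set \<Rightarrow> real"
  where "inj_on c perfect_sets" "\<And>P. P \<in> perfect_sets \<Longrightarrow> c P \<in> P - A"
    "A \<subseteq> {0..1}" "uncountable A" "\<And>P. P \<in> perfect_sets \<Longrightarrow> A \<inter> P \<noteq> {}"
proof -
  let ?I = "perfect_sets \<times> (UNIV :: bool set)"
  have "perfect_sets \<lesssim> (UNIV :: real set)"
    using closed_sets_lepoll_real subset_imp_lepoll[of perfect_sets "{C. closed C}"] lepoll_trans
    by (fastforce simp: perfect_sets_def)
  moreover have "(UNIV :: bool set) \<lesssim> (UNIV :: real set)"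
    by (simp add: finite_lepoll_infinite infinite_UNIV_char_0)
  ultimately have "?I \<lesssim> (UNIV :: real set) \<times> (UNIV :: real set)"
    by (rule times_lepoll_mono)
  then have I: "?I \<lesssim> (UNIV :: real set)"
    using real_product_lepoll_real lepoll_trans by fastforce
  have "?I \<lesssim> fst i" if "i \<in> ?I" for i
    using I real_lepoll_perfect_set[of "fst i"] that lepoll_trans
    by (fastforce simp: perfect_sets_def)
  then obtain d where d: "inj_on d ?I" "\<And>i. i \<in> ?I \<Longrightarrow> d i \<in> fst i"
    using injective_choice_if_lepoll[of ?I fst] by blast
  show ?thesis
  proof (rule that)
    let ?A = "(\<lambda>P. d (P, False)) ` perfect_sets"
    show "inj_on (\<lambda>P. d (P, True)) perfect_sets"
      using d(1) by (auto simp: inj_on_def)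
    show "d (P, True) \<in> P - ?A" if "P \<in> perfect_sets" for P
    proof -
      have "d (P, True) \<noteq> d (Q, False)" if "Q \<in> perfect_sets" for Q
        using inj_onD[OF d(1), of "(P, True)" "(Q, False)"] \<open>P \<in> perfect_sets\<close> that by auto
      then show ?thesis
        using d(2)[of "(P, True)"] that by auto
    qed
    have dP: "d (P, False) \<in> P" if "P \<in> perfect_sets" for P
      using d(2)[of "(P, False)"] that by simp
    moreover have "P \<subseteq> {0..1}" if "P \<in> perfect_sets" for P
      using that by (simp add: perfect_sets_def)
    ultimately show "?A \<subseteq> {0..1}"
      by blast
    show "?A \<inter> P \<noteq> {}" if "P \<in> perfect_sets" for P
      using dP that by blast
    have "inj_on (\<lambda>P. d (P, False)) perfect_sets"
      using d(1) by (auto simp: inj_on_def)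
    then show "uncountable ?A"
      using uncountable_perfect_sets countable_image_inj_on by blast
  qed
qed

section \<open>Resolutions of the unit interval\<close>

text \<open>Sort the points of \<open>D\<close> by a scale 1/(n+1) at which they are isolated in
  \<open>D\<close>. Points isolated at the same scale are uniformly separated, so total boundedness
  leaves only finitely many for each n.\<close>

lemma countable_if_isolated_in_compact_metrizable:
  assumes "compact_space X" "metrizable_space X" "D \<subseteq> topspace X"
    and isolated: "\<And>d. d \<in> D \<Longrightarrow> \<exists>U. openin X U \<and> U \<inter> D = {d}"
  shows "countable D"
proof -
  obtain M m where "Metric_space M m" and X: "X = Metric_space.mtopology M m"
    using assms(2) unfolding metrizable_space_def by blast
  then interpret Metric_space M m
    by simp
  have "\<exists>n. mball d (inverse (Suc n)) \<inter> D \<subseteq> {d}" if d: "d \<in> D" for d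
  proof -
    obtain U where U: "openin mtopology U" "U \<inter> D = {d}"
      using isolated[OF d] X by blast
    then obtain e where "e > 0" "mball d e \<subseteq> U"
      unfolding openin_mtopology by blast
    moreover obtain n where "inverse (real (Suc n)) < e"
      using reals_Archimedean[OF \<open>e > 0\<close>] by blast
    ultimately show ?thesis
      using U(2) mball_subset_concentric[of "inverse (real (Suc n))" e d] by fastforce
  qed
  then have "D \<subseteq> (\<Union>n. {d \<in> D. mball d (inverse (Suc n)) \<inter> D \<subseteq> {d}})"
    by blast
  moreover have "finite {d \<in> D. mball d (inverse (Suc n)) \<inter> D \<subseteq> {d}}" (is "finite ?D") for n
  proof -
    have "mtotally_bounded M"
      using assms(1) compactin_imp_mtotally_bounded by (simp add: X compact_space_def)
    \<comment> \<open>Balls of half the radius: two points near the same centre are then closer than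
      the full radius, so distinct points isolated at this scale need distinct centres.\<close>
    then obtain F where F: "finite F" "M \<subseteq> (\<Union>x\<in>F. mball x (inverse (Suc n) / 2))"
      unfolding mtotally_bounded_def by (metis half_gt_zero inverse_positive_iff_positive of_nat_0_less_iff zero_less_Suc)
    have "\<forall>d\<in>D. \<exists>x\<in>F. d \<in> mball x (inverse (Suc n) / 2)"
      using F(2) assms(3) X topspace_mtopology by blast
    then obtain c where c: "\<And>d. d \<in> D \<Longrightarrow> c d \<in> F \<and> d \<in> mball (c d) (inverse (Suc n) / 2)"
      by metis
    have "inj_on c ?D"
    proof (rule inj_onI)
      fix d d' assume d: "d \<in> ?D" "d' \<in> ?D" "c d = c d'"
      then have *: "d \<in> mball (c d) (inverse (Suc n) / 2)" "d' \<in> mball (c d) (inverse (Suc n) / 2)"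
        using c[of d] c[of d'] by simp_all
      then have "m d d' < inverse (Suc n)"
        using triangle[of d "c d" d'] commute[of "c d" d] by (simp add: in_mball)
      with * have "d' \<in> mball d (inverse (Suc n))"
        by (simp add: in_mball)
      with d show "d = d'"
        by auto
    qed
    moreover have "c ` ?D \<subseteq> F"
      using c by auto
    ultimately show ?thesis
      using F(1) finite_imageD finite_subset by blast
  qed
  ultimately show ?thesis
    by (meson countable_UN countable_finite countable_subset countableI_type)
qed

text \<open>The fibre over x is the product of the sections of all \<open>G y\<close> at x. If each
  \<open>G y\<close> is single-valued off y, only the coordinate with index x can vary in that
  fibre.\<close>

definition resolution :: "(real \<Rightarrow> (real \<times> real) set) \<Rightarrow> (real \<times> (real \<Rightarrow> real)) set" where
  "resolution G = {(x, t). \<forall>y. (x, t y) \<in> G y}"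

lemma continuous_on_coordinate [continuous_intros]:
  "continuous_on S (\<lambda>p :: 'a::topological_space \<times> ('b \<Rightarrow> 'c::topological_space). snd p y)"
  by (rule continuous_on_product_then_coordinatewise[OF continuous_on_snd[OF continuous_on_id]])

definition graph_off :: "real \<Rightarrow> (real \<times> real) set \<Rightarrow> bool" where
  "graph_off y H \<longleftrightarrow> closed H \<and> H \<subseteq> {0..1} \<times> {0..1} \<and> (\<forall>x\<in>{0..1}. \<exists>s. (x, s) \<in> H) \<and>
     (\<forall>x s s'. x \<noteq> y \<longrightarrow> (x, s) \<in> H \<longrightarrow> (x, s') \<in> H \<longrightarrow> s = s')"

locale point_resolution =
  fixes G :: "real \<Rightarrow> (real \<times> real) set"
  assumes graph_off_G: "graph_off y (G y)"
begin

lemma closed_G: "closed (G y)"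
  and G_subset: "G y \<subseteq> {0..1} \<times> {0..1}"
  and G_total: "x \<in> {0..1} \<Longrightarrow> \<exists>s. (x, s) \<in> G y"
  and G_unique: "x \<noteq> y \<Longrightarrow> (x, s) \<in> G y \<Longrightarrow> (x, s') \<in> G y \<Longrightarrow> s = s'"
  using graph_off_G[of y] unfolding graph_off_def by blast+

lemma compact_resolution: "compact (resolution G)"
proof -
  have "compactin (product_topology (\<lambda>_. euclideanreal) UNIV) (\<Pi>\<^sub>E y\<in>(UNIV::real set). {0..1::real})"
    unfolding compactin_PiE by auto
  then have "compact (\<Pi>\<^sub>E y\<in>(UNIV::real set). {0..1::real})"
    unfolding euclidean_product_topology by simp
  then have "compact ({0..1::real} \<times> (\<Pi>\<^sub>E y\<in>(UNIV::real set). {0..1::real}))"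
    by (intro compact_Times compact_Icc)
  moreover have "closed (resolution G)"
  proof -
    have "resolution G = (\<Inter>y. (\<lambda>p. (fst p, snd p y)) -` G y)"
      by (auto simp: resolution_def)
    moreover have "closed ((\<lambda>p. (fst p, snd p y)) -` G y)" for y
      by (intro closed_vimage closed_G continuous_intros)
    ultimately show ?thesis
      by auto
  qed
  moreover have "resolution G \<subseteq> {0..1} \<times> (\<Pi>\<^sub>E y\<in>UNIV. {0..1})"
    using G_subset by (fastforce simp: resolution_def)
  ultimately show ?thesis
    by (metis compact_Int_closed inf.absorb_iff2)
qed

lemma Hausdorff_resolution: "Hausdorff_space (top_of_set (resolution G))"
proof -
  have "Hausdorff_space (product_topology (\<lambda>_. euclideanreal) (UNIV :: real set))"
    by (simp add: Hausdorff_space_product_topology)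
  then have "Hausdorff_space (euclidean :: (real \<Rightarrow> real) topology)"
    unfolding euclidean_product_topology .
  then have "Hausdorff_space (prod_topology euclideanreal (euclidean :: (real \<Rightarrow> real) topology))"
    by (simp add: Hausdorff_space_prod_topology del: prod_topology_euclidean)
  then show ?thesis
    by (auto intro: Hausdorff_space_subtopology)
qed

lemma fibre_unique:
  assumes "(x, t) \<in> resolution G" "(x, t') \<in> resolution G" "t x = t' x"
  shows "t = t'"
proof
  fix y
  have "(x, t y) \<in> G y" "(x, t' y) \<in> G y"
    using assms(1,2) by (simp_all add: resolution_def)
  then show "t y = t' y"
    using assms(3) G_unique by (cases "x = y") blast+
qed

lemma point_over:
  assumes "(y, s) \<in> G y"
  shows "\<exists>t. (y, t) \<in> resolution G \<and> t y = s"
proof -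
  have "y \<in> {0..1}"
    using assms G_subset by blast
  then obtain t where "\<And>z. (y, t z) \<in> G z"
    using G_total by metis
  then show ?thesis
    using assms by (intro exI[of _ "t(y := s)"]) (auto simp: resolution_def)
qed

text \<open>The pair of points of the fibre over \<open>y\<close> with coordinates 0 and 1 at \<open>y\<close> is isolated among
  all such pairs in the square of the space, since these two coordinates agree over any other point.\<close>

lemma not_metrizable_resolution:
  assumes "uncountable {y. (y, 0) \<in> G y \<and> (y, 1) \<in> G y}"
  shows "\<not> metrizable_space (top_of_set (resolution G))"
proof
  let ?Y = "{y. (y, 0) \<in> G y \<and> (y, 1) \<in> G y}"
  let ?K = "top_of_set (resolution G)"
  assume "metrizable_space ?K"
  have "\<forall>y\<in>?Y. \<exists>t. (y, t) \<in> resolution G \<and> t y = 0" "\<forall>y\<in>?Y. \<exists>t. (y, t) \<in> resolution G \<and> t y = 1"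
    by (simp_all add: point_over)
  then obtain a b where "\<forall>y\<in>?Y. (y, a y) \<in> resolution G \<and> a y y = 0"
      "\<forall>y\<in>?Y. (y, b y) \<in> resolution G \<and> b y y = 1"
    unfolding bchoice_iff by (elim exE)
  then have ab: "(y, a y) \<in> resolution G \<and> (y, b y) \<in> resolution G \<and> a y y = 0 \<and> b y y = 1"
    if "y \<in> ?Y" for y
    using that by blast
  define D where "D = (\<lambda>y. ((y, a y), (y, b y))) ` ?Y"
  have "\<exists>U. openin (prod_topology ?K ?K) U \<and> U \<inter> D = {d}" if d: "d \<in> D" for d
  proof -
    obtain y where y: "y \<in> ?Y" "d = ((y, a y), (y, b y))"
      using d by (auto simp: D_def)
    have "openin ?K (resolution G \<inter> (\<lambda>p. snd p y) -` {..<1/2})"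
         "openin ?K (resolution G \<inter> (\<lambda>p. snd p y) -` {1/2<..})"
      by (intro continuous_openin_preimage_gen continuous_intros open_lessThan open_greaterThan)+
    then have "openin (prod_topology ?K ?K)
        ((resolution G \<inter> (\<lambda>p. snd p y) -` {..<1/2}) \<times> (resolution G \<inter> (\<lambda>p. snd p y) -` {1/2<..}))"
      (is "openin _ ?U")
      unfolding openin_prod_Times_iff by blast
    moreover have "z = y" if "z \<in> ?Y" "((z, a z), (z, b z)) \<in> ?U" for z
    proof (rule ccontr)
      assume "z \<noteq> y"
      moreover have "(z, a z y) \<in> G y" "(z, b z y) \<in> G y"
        using ab[OF that(1)] by (simp_all add: resolution_def)
      ultimately have "a z y = b z y"
        by (rule G_unique)
      with that(2) show False
        by auto
    qed
    moreover have "d \<in> ?U"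
      unfolding y(2) using ab[OF y(1)] by simp
    ultimately have "openin (prod_topology ?K ?K) ?U \<and> ?U \<inter> D = {d}"
      using d y(2) unfolding D_def by blast
    then show ?thesis
      by (rule exI)
  qed
  moreover have "D \<subseteq> topspace (prod_topology ?K ?K)"
    using ab by (auto simp: D_def)
  moreover have "compact_space (prod_topology ?K ?K)"
    using compact_resolution unfolding compact_space_prod_topology by (simp add: compact_space_subtopology)
  moreover have "metrizable_space (prod_topology ?K ?K)"
    using \<open>metrizable_space ?K\<close> unfolding metrizable_space_prod_topology by blast
  ultimately have "countable D"
    by (intro countable_if_isolated_in_compact_metrizable)
  moreover have "inj_on (\<lambda>y. ((y, a y), (y, b y))) ?Y"
    by (auto intro: inj_onI)
  ultimately show False
    using assms countable_image_inj_on unfolding D_def by blast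
qed

text \<open>A point over x is determined by x and its coordinate at x. Hence the base point together
  with the coordinates indexed by the countable projection already separates the points of
  \<open>S\<close>.\<close>

lemma metrizable_if_countable_projection:
  assumes "S \<subseteq> resolution G" "compact S" "countable (fst ` S)"
  shows "metrizable_space (top_of_set S)"
proof -
  \<comment> \<open>For empty \<open>S\<close> this enumeration has unspecified values, but then
    there is nothing to separate.\<close>
  define c where "c = from_nat_into (fst ` S)"
  define h where "h p = (fst p, \<lambda>n. snd p (c n))" for p :: "real \<times> (real \<Rightarrow> real)"
  have "inj_on h S"
  proof (rule inj_onI)
    fix p q assume pq: "p \<in> S" "q \<in> S" "h p = h q"
    obtain n where "c n = fst p"
      using from_nat_into_surj[OF assms(3)] pq(1) unfolding c_def by (metis imageI)
    moreover have "snd p (c n) = snd q (c n)"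
      using pq(3) unfolding h_def by (metis prod.inject)
    moreover have "fst p = fst q"
      using pq(3) by (simp add: h_def)
    ultimately show "p = q"
      using fibre_unique[of "fst p" "snd p" "snd q"] pq(1,2) assms(1) by (metis prod.collapse subsetD)
  qed
  moreover have "continuous_on S h"
    unfolding h_def by (intro continuous_intros continuous_on_coordinatewise_then_product)
  \<comment> \<open>A continuous injection of a compact space into a Hausdorff space is a
    homeomorphism onto its image; here the target is a countable power of the line.\<close>
  ultimately have "homeomorphic_map (top_of_set S) (top_of_set (h ` S)) h"
    using assms(2)
    by (intro continuous_imp_homeomorphic_map)
       (auto simp: compact_space_subtopology Hausdorff_space_subtopology)
  then have "top_of_set S homeomorphic_space top_of_set (h ` S)"
    by (rule homeomorphic_map_imp_homeomorphic_space)
  moreover have "metrizable_space (top_of_set (h ` S))"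
    by (simp add: metrizable_space_euclidean metrizable_space_subtopology)
  ultimately show ?thesis
    using homeomorphic_metrizable_space by blast
qed

text \<open>Over points of \<open>P\<close> other than y, the coordinate at y is forced to be the
  value of \<open>f\<close>. So the compact image of \<open>S\<close> under base point and
  y-coordinate contains the graph, hence its closure, hence the whole segment over y; the
  y-coordinate then identifies the point of the fibre.\<close>

lemma fibre_subset_if_dense_graph:
  assumes S: "S \<subseteq> resolution G" "compact S"
    and P: "P \<subseteq> fst ` S" and graph: "\<And>x. x \<in> P - {y} \<Longrightarrow> (x, f x) \<in> G y"
    and dense: "\<And>s. s \<in> {0..1} \<Longrightarrow> (y, s) \<in> closure ((\<lambda>x. (x, f x)) ` (P - {y}))"
    and t: "(y, t) \<in> resolution G"
  shows "(y, t) \<in> S"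
proof -
  let ?h = "\<lambda>p. (fst p, snd p y)"
  have "compact (?h ` S)"
    using S(2) by (intro compact_continuous_image continuous_intros)
  moreover have "(\<lambda>x. (x, f x)) ` (P - {y}) \<subseteq> ?h ` S"
  proof (rule image_subsetI)
    fix x assume "x \<in> P - {y}"
    then have x: "x \<in> P" "x \<noteq> y"
      by auto
    then obtain u where u: "(x, u) \<in> S"
      using P by force
    then have "u y = f x"
      using S(1) graph[of x] x G_unique[of x y] by (auto simp: resolution_def)
    with u show "(x, f x) \<in> ?h ` S"
      by force
  qed
  ultimately have "closure ((\<lambda>x. (x, f x)) ` (P - {y})) \<subseteq> ?h ` S"
    by (simp add: closure_minimal compact_imp_closed)
  moreover have "t y \<in> {0..1}"
    using t G_subset[of y] by (auto simp: resolution_def)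
  ultimately have "(y, t y) \<in> ?h ` S"
    using dense by blast
  then obtain u where "(y, u) \<in> S" "u y = t y"
    by auto
  then show ?thesis
    using fibre_unique[of y u t] t S(1) by auto
qed

text \<open>Moving only the coordinate at y from 0 to 1 traces an arc inside the fibre over
  y.\<close>

lemma not_totally_disconnected_if_fibre_subset:
  assumes "\<And>s. s \<in> {0..1} \<Longrightarrow> (y, s) \<in> G y" and sub: "\<And>t. (y, t) \<in> resolution G \<Longrightarrow> (y, t) \<in> S"
  shows "\<not> totally_disconnected_space (top_of_set S)"
proof
  assume td: "totally_disconnected_space (top_of_set S)"
  obtain t where t: "(y, t) \<in> resolution G"
    using point_over[OF assms(1)[of 0]] by auto
  let ?arc = "\<lambda>s. (y, t(y := s))"
  have "continuous_on {0..1} (\<lambda>s. (t(y := s)) i)" for i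
    by (cases "i = y") auto
  then have "continuous_on {0..1} ?arc"
    by (intro continuous_on_Pair continuous_on_const continuous_on_coordinatewise_then_product)
  then have "connected (?arc ` {0..1})"
    by (intro connected_continuous_image) auto
  moreover have "?arc ` {0..1} \<subseteq> S"
    using assms(1) t by (auto intro!: sub simp: resolution_def)
  ultimately have "connectedin (top_of_set S) (?arc ` {0..1})"
    by (simp add: connectedin_subtopology)
  then have "?arc 0 = ?arc 1"
    using td unfolding totally_disconnected_space_def by (meson atLeastAtMost_iff imageI order_refl zero_le_one)
  then show False
    by (auto dest: fun_cong[of _ _ y])
qed

end

section \<open>Jump and oscillation relations at a single point\<close>

text \<open>For y in the unit interval both values are kept at y, even at an endpoint: y is split
  into two points, as in the split interval.\<close>

definition step_graph :: "real \<Rightarrow> (real \<times> real) set" where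
  "step_graph y = {0..y} \<times> {0} \<union> {y..1} \<times> {1}"

definition osc_graph :: "real \<Rightarrow> (real \<Rightarrow> real) \<Rightarrow> (real \<times> real) set" where
  "osc_graph y f = {(x, s). x \<in> {0..1} \<and> s \<in> {0..1} \<and> (x = y \<or> s = f x)}"

lemma graph_off_step_graph: "y \<in> {0..1} \<Longrightarrow> graph_off y (step_graph y)"
proof -
  assume y: "y \<in> {0..1}"
  have "closed (step_graph y)"
    unfolding step_graph_def by (intro closed_Un closed_Times closed_atLeastAtMost closed_singleton)
  moreover have "\<exists>s. (x, s) \<in> step_graph y" if "x \<in> {0..1}" for x
    using that by (cases "x \<le> y") (auto simp: step_graph_def)
  ultimately show ?thesis
    using y unfolding graph_off_def by (auto simp: step_graph_def)
qed

lemma graph_off_zero: "graph_off y ({0..1} \<times> {0})"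
proof -
  have "closed ({0..1::real} \<times> {0::real})"
    by (intro closed_Times closed_atLeastAtMost closed_singleton)
  then show ?thesis
    by (auto simp: graph_off_def)
qed

text \<open>Only closedness needs an argument: limits over other points are controlled by continuity
  of \<open>f\<close>, while limits over y fall into the full vertical segment.\<close>

lemma graph_off_osc_graph:
  assumes "continuous_on (- {y}) f" "\<And>x. x \<noteq> y \<Longrightarrow> f x \<in> {0..1}"
  shows "graph_off y (osc_graph y f)"
proof -
  have "closed (osc_graph y f)"
    unfolding closed_sequential_limits
  proof (intro allI impI, elim conjE)
    fix p l assume p: "\<forall>n. p n \<in> osc_graph y f" and lim: "p \<longlonglongrightarrow> l"
    have lim': "(\<lambda>n. fst (p n)) \<longlonglongrightarrow> fst l" "(\<lambda>n. snd (p n)) \<longlonglongrightarrow> snd l"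
      using lim by (auto intro: tendsto_intros)
    have "closed ({0..1::real} \<times> {0..1::real})"
      by (intro closed_Times closed_atLeastAtMost)
    moreover have "p n \<in> {0..1} \<times> {0..1}" for n
      using p[rule_format, of n] unfolding osc_graph_def by (cases "p n") simp
    ultimately have "l \<in> {0..1} \<times> {0..1}"
      using lim by (rule closed_sequentially)
    moreover have "snd l = f (fst l)" if "fst l \<noteq> y"
    proof (rule LIMSEQ_unique[OF lim'(2)])
      have "isCont f (fst l)"
        using assms(1) that by (simp add: continuous_on_eq_continuous_at open_Compl)
      then have "(\<lambda>n. f (fst (p n))) \<longlonglongrightarrow> f (fst l)"
        using lim'(1) by (rule isCont_tendsto_compose)
      moreover have "eventually (\<lambda>n. fst (p n) \<noteq> y) sequentially"
        using lim'(1) that by (rule tendsto_imp_eventually_ne)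
      then have "eventually (\<lambda>n. f (fst (p n)) = snd (p n)) sequentially"
      proof eventually_elim
        case (elim n)
        then show ?case
          using p[rule_format, of n] by (auto simp: osc_graph_def)
      qed
      ultimately show "(\<lambda>n. snd (p n)) \<longlonglongrightarrow> f (fst l)"
        by (rule Lim_transform_eventually)
    qed
    ultimately show "l \<in> osc_graph y f"
      by (cases l) (auto simp: osc_graph_def)
  qed
  moreover have "\<exists>s. (x, s) \<in> osc_graph y f" if "x \<in> {0..1}" for x
    using that assms(2)[of x] by (cases "x = y") (auto simp: osc_graph_def)
  ultimately show ?thesis
    unfolding graph_off_def by (auto simp: osc_graph_def)
qed

text \<open>Choose an injective sequence in \<open>P\<close> tending to y. Its range is closed and
  discrete in the complement of y, so arbitrary values on it extend by Tietze; values that keep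
  returning to each point of a dense set make the graph accumulate on the whole segment.\<close>

lemma oscillating_function:
  fixes P :: "real set"
  assumes "y islimpt P"
  obtains f :: "real \<Rightarrow> real" where "continuous_on (- {y}) f" "\<And>x. x \<noteq> y \<Longrightarrow> f x \<in> {0..1}"
    "\<And>s. s \<in> {0..1} \<Longrightarrow> (y, s) \<in> closure ((\<lambda>x. (x, f x)) ` (P - {y}))"
proof -
  obtain u :: "nat \<Rightarrow> real" where u: "\<And>n. u n \<in> P - {y}" "inj u" "u \<longlonglongrightarrow> y"
    using assms unfolding limpt_sequential_inj by blast
  obtain D :: "real set" where D: "countable D" "D \<subseteq> {0..1}" "{0..1} \<subseteq> closure D"
    using separable[of "{0..1::real}"] by blast
  then have "D \<noteq> {}"
    by auto
  \<comment> \<open>Every value of \<open>D\<close> is taken infinitely often along \<open>u\<close>.\<close>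
  define q where "q n = from_nat_into D (fst (prod_decode n))" for n
  have q01: "q n \<in> {0..1}" for n
    using D(2) from_nat_into[OF \<open>D \<noteq> {}\<close>] unfolding q_def by blast
  have "continuous_on (range u) (\<lambda>x. q (inv u x))"
    unfolding continuous_on_def
  proof
    fix x assume "x \<in> range u"
    then have "\<not> x islimpt range u"
      using sequence_unique_limpt[OF u(3)] u(1) by blast
    then have "at x within range u = bot"
      by (simp add: trivial_limit_within)
    then show "((\<lambda>x. q (inv u x)) \<longlongrightarrow> q (inv u x)) (at x within range u)"
      by simp
  qed
  moreover have "closedin (top_of_set (- {y})) (range u)"
  proof -
    have "range u = - {y} \<inter> insert y (range u)"
      using u(1) by auto
    then show ?thesis
      using compact_imp_closed[OF compact_sequence_with_limit[OF u(3)]] closedin_closed by blast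
  qed
  ultimately obtain f where f: "continuous_on (- {y}) f" "\<And>x. x \<in> range u \<Longrightarrow> f x = q (inv u x)"
      "\<And>x. x \<in> - {y} \<Longrightarrow> f x \<in> cbox 0 1"
    using Tietze_closed_interval_1[of "range u" "\<lambda>x. q (inv u x)" "- {y}" 0 1] q01
    by (metis box_real(2) zero_le_one)
  have fu: "f (u n) = q n" for n
    using f(2)[of "u n"] u(2) by simp
  have "(y, s) \<in> closure ((\<lambda>x. (x, f x)) ` (P - {y}))" if "s \<in> {0..1}" for s
  proof -
    have "{y} \<times> D \<subseteq> closure ((\<lambda>x. (x, f x)) ` (P - {y}))"
    proof safe
      fix d assume "d \<in> D"
      then obtain m where m: "d = from_nat_into D m"
        using D(1) by (metis from_nat_into_to_nat_on)
      \<comment> \<open>The indices with first component \<open>m\<close> form an unbounded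
        sequence, since the code of a pair is at least its second component. Along it
        \<open>f\<close> has the constant value \<open>d\<close>.\<close>
      have "filterlim (\<lambda>k. prod_encode (m, k)) at_top sequentially"
        by (rule filterlim_at_top_mono[OF filterlim_ident]) (simp add: le_prod_encode_2)
      then have "(\<lambda>k. u (prod_encode (m, k))) \<longlonglongrightarrow> y"
        using u(3) by (rule filterlim_compose[rotated])
      moreover have "q (prod_encode (m, k)) = d" for k
        by (simp add: q_def m)
      ultimately have "(\<lambda>k. (u (prod_encode (m, k)), f (u (prod_encode (m, k))))) \<longlonglongrightarrow> (y, d)"
        by (auto simp: fu intro!: tendsto_Pair)
      moreover have "(u n, f (u n)) \<in> (\<lambda>x. (x, f x)) ` (P - {y})" for n
        using u(1) by blast
      ultimately show "(y, d) \<in> closure ((\<lambda>x. (x, f x)) ` (P - {y}))"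
        unfolding closure_sequential by (intro exI conjI allI)
    qed
    then have "closure ({y} \<times> D) \<subseteq> closure ((\<lambda>x. (x, f x)) ` (P - {y}))"
      by (simp add: closure_minimal)
    then show ?thesis
      using that D(3) by (auto simp: closure_Times)
  qed
  with f show ?thesis
    using that by auto
qed

section \<open>Totally disconnected subsets and the split interval\<close>

lemma (in point_resolution) good_space_resolution:
  assumes unc: "uncountable {y. (y, 0) \<in> G y \<and> (y, 1) \<in> G y}"
    and osc: "\<And>P. P \<in> perfect_sets \<Longrightarrow> \<exists>y f. G y = osc_graph y f \<and> y \<in> {0..1} \<and>
      (\<forall>x. x \<noteq> y \<longrightarrow> f x \<in> {0..1}) \<and>
      (\<forall>s\<in>{0..1}. (y, s) \<in> closure ((\<lambda>x. (x, f x)) ` (P - {y})))"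
  shows "good_space (top_of_set (resolution G))"
proof -
  have "metrizable_space (top_of_set S)"
    if S: "S \<subseteq> resolution G" "compact S" and td: "totally_disconnected_space (top_of_set S)" for S
  proof (rule metrizable_if_countable_projection[OF S], rule ccontr)
    assume unc: "uncountable (fst ` S)"
    have "compact (fst ` S)"
      using S(2) by (intro compact_continuous_image continuous_intros)
    then have "closed (fst ` S)"
      by (rule compact_imp_closed)
    \<comment> \<open>An uncountable projection contains a perfect set; the oscillation attached to
      it forces a full fibre, and thus an arc, into \<open>S\<close>.\<close>
    then obtain P where P: "closed P" "P \<noteq> {}" "P \<subseteq> fst ` S" "\<And>x. x \<in> P \<Longrightarrow> x islimpt P"
      using unc uncountable_closed_contains_perfect by blast
    have "fst ` S \<subseteq> {0..1}"
      using S(1) G_subset unfolding resolution_def by fastforce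
    with P have P01: "P \<subseteq> {0..1}" and "P \<in> perfect_sets"
      unfolding perfect_sets_def by auto
    then obtain y f where y: "G y = osc_graph y f" "y \<in> {0..1}" and f: "\<And>x. x \<noteq> y \<Longrightarrow> f x \<in> {0..1}"
        and dense: "\<And>s. s \<in> {0..1} \<Longrightarrow> (y, s) \<in> closure ((\<lambda>x. (x, f x)) ` (P - {y}))"
      using osc by meson
    have "(x, f x) \<in> G y" if "x \<in> P - {y}" for x
      using that P01 f[of x] by (auto simp: y(1) osc_graph_def)
    then have "(y, t) \<in> S" if "(y, t) \<in> resolution G" for t
      using fibre_subset_if_dense_graph[OF S P(3) _ dense that] by blast
    moreover have "(y, s) \<in> G y" if "s \<in> {0..1}" for s
      using that y by (simp add: osc_graph_def)
    ultimately show False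
      using not_totally_disconnected_if_fibre_subset td by blast
  qed
  moreover have "S \<subseteq> resolution G \<and> compact S \<and> subtopology (top_of_set (resolution G)) S = top_of_set S"
    if "closedin (top_of_set (resolution G)) S" for S
    using that closedin_compact[OF compact_resolution] closedin_subset[OF that]
    by (simp add: subtopology_subtopology inf.absorb2)
  moreover have "compact_space (top_of_set (resolution G))"
    using compact_resolution by (simp add: compact_space_subtopology)
  ultimately show ?thesis
    using Hausdorff_resolution not_metrizable_resolution[OF unc] unfolding good_space_def by metis
qed

text \<open>On a connected set every coordinate in \<open>A\<close> is constant, having at most the
  values 0 and 1. Two different base points would have a point of \<open>A\<close> strictly between
  them, whose coordinate is 0 on the left and 1 on the right.\<close>

lemma totally_disconnected_resolution_step_graph:
  assumes dense: "\<And>a b. 0 \<le> a \<Longrightarrow> a < b \<Longrightarrow> b \<le> 1 \<Longrightarrow> \<exists>y\<in>A. a < y \<and> y < b"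
  shows "totally_disconnected_space
    (top_of_set (resolution (\<lambda>y. if y \<in> A then step_graph y else {0..1} \<times> {0})))"
    (is "totally_disconnected_space (top_of_set (resolution ?G))")
  unfolding totally_disconnected_space_def
proof (intro allI impI ballI, rule ccontr)
  fix S p q
  assume "connectedin (top_of_set (resolution ?G)) S" and pq: "p \<in> S" "q \<in> S" "p \<noteq> q"
  then have S: "connected S" "S \<subseteq> resolution ?G"
    by (auto simp: connectedin_subtopology)
  have in_G: "(fst r, snd r y) \<in> ?G y" if "r \<in> S" for r y
    using subsetD[OF S(2) that] unfolding resolution_def case_prod_beta by blast
  have step: "(fst r, snd r y) \<in> step_graph y" if "r \<in> S" "y \<in> A" for r y
    using in_G[OF that(1), of y] that(2) by simp
  have const: "snd r y = snd r' y" if "r \<in> S" "r' \<in> S" "y \<in> A" for r r' y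
  proof -
    have "connected ((\<lambda>r. snd r y) ` S)"
      using S(1) by (intro connected_continuous_image continuous_intros)
    moreover have "(\<lambda>r. snd r y) ` S \<subseteq> {0, 1}"
      using step \<open>y \<in> A\<close> by (fastforce simp: step_graph_def)
    then have "finite ((\<lambda>r. snd r y) ` S)"
      by (rule finite_subset) simp
    ultimately have "(\<lambda>r. snd r y) ` S = {} \<or> (\<exists>z. (\<lambda>r. snd r y) ` S = {z})"
      by (simp add: connected_finite_iff_sing)
    then show ?thesis
      using imageI[OF that(1), of "\<lambda>r. snd r y"] imageI[OF that(2), of "\<lambda>r. snd r y"]
      by (metis empty_iff singletonD)
  qed
  have snd_eq: "snd p = snd q"
  proof
    fix y
    show "snd p y = snd q y"
    proof (cases "y \<in> A")
      case False
      then show ?thesis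
        using in_G[OF pq(1), of y] in_G[OF pq(2), of y] by simp
    qed (use const pq in blast)
  qed
  have fst01: "fst r \<in> {0..1}" if "r \<in> S" for r
    using in_G[OF that, of 0] by (auto simp: step_graph_def split: if_splits)
  have less: False if rs: "r \<in> S" "r' \<in> S" "fst r < fst r'" for r r'
  proof -
    obtain y where y: "y \<in> A" "fst r < y" "y < fst r'"
      using dense[of "fst r" "fst r'"] fst01[OF rs(1)] fst01[OF rs(2)] rs(3) by auto
    then have "snd r y = 0" "snd r' y = 1"
      using step[OF rs(1) y(1)] step[OF rs(2) y(1)] by (auto simp: step_graph_def)
    then show False
      using const[OF rs(1,2) y(1)] by simp
  qed
  have "fst p = fst q"
    using less[of p q] less[of q p] pq(1,2) by force
  with snd_eq pq(3) show False
    by (simp add: prod_eq_iff)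
qed

section \<open>Transfer along homeomorphisms\<close>

text \<open>Moves a space to a prescribed type of points: the copy lives on the image of
  \<open>e\<close>, with the topology pulled back along the inverse.\<close>

lemma homeomorphic_copy_along_injection:
  fixes X :: "'a topology" and e :: "'a \<Rightarrow> 'b"
  assumes "inj e"
  obtains Y :: "'b topology" where "X homeomorphic_space Y"
proof
  let ?Y = "pullback_topology (e ` topspace X) (inv e) X"
  have "inv e \<circ> e = id"
    using assms by simp
  then have "continuous_map X ?Y e"
    by (intro continuous_map_pullback') auto
  moreover have "continuous_map ?Y X (inv e)"
    using continuous_map_pullback[OF continuous_map_id, of "e ` topspace X" "inv e" X] by simp
  ultimately have "homeomorphic_maps X ?Y e (inv e)"
    using assms by (auto simp: homeomorphic_maps_def topspace_pullback_topology)
  then show "X homeomorphic_space ?Y"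
    unfolding homeomorphic_space_def by blast
qed

lemma totally_disconnected_space_homeomorphic:
  assumes "X homeomorphic_space Y" "totally_disconnected_space X"
  shows "totally_disconnected_space Y"
  unfolding totally_disconnected_space_def
proof (intro allI impI ballI)
  fix S x y assume S: "connectedin Y S" and xy: "x \<in> S" "y \<in> S"
  obtain f g where "homeomorphic_maps X Y f g"
    using assms(1) unfolding homeomorphic_space_def by blast
  then have g: "continuous_map Y X g" "\<And>z. z \<in> topspace Y \<Longrightarrow> f (g z) = z"
    by (auto simp: homeomorphic_maps_def)
  have "g x = g y"
    using assms(2) connectedin_continuous_map_image[OF g(1) S] xy
    unfolding totally_disconnected_space_def by blast
  then show "x = y"
    using g(2) connectedin_subset_topspace[OF S] xy by (metis subsetD)
qed

lemma good_space_homeomorphic: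
  assumes "X homeomorphic_space Y" "good_space X"
  shows "good_space Y"
proof -
  obtain g where g: "homeomorphic_map Y X g"
    using assms(1) homeomorphic_space homeomorphic_space_sym by blast
  have "metrizable_space (subtopology Y S)"
    if S: "closedin Y S" "totally_disconnected_space (subtopology Y S)" for S
  proof -
    have sub: "S \<subseteq> topspace Y"
      using S(1) by (rule closedin_subset)
    have "closedin X (g ` S)"
      using g S(1) homeomorphic_map_closedness sub by blast
    moreover have "homeomorphic_map (subtopology Y S) (subtopology X (g ` S)) g"
      using g sub homeomorphic_imp_surjective_map[OF g]
      by (intro homeomorphic_map_subtopologies) (auto simp: Int_absorb1 image_mono)
    then have hom: "subtopology Y S homeomorphic_space subtopology X (g ` S)"
      by (rule homeomorphic_map_imp_homeomorphic_space)
    ultimately have "metrizable_space (subtopology X (g ` S))"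
      using assms(2) totally_disconnected_space_homeomorphic[OF hom S(2)]
      unfolding good_space_def by blast
    then show ?thesis
      using homeomorphic_metrizable_space[OF hom] by blast
  qed
  then show ?thesis
    using assms(2) homeomorphic_compact_space[OF assms(1)] homeomorphic_Hausdorff_space[OF assms(1)]
      homeomorphic_metrizable_space[OF assms(1)]
    unfolding good_space_def by blast
qed

text \<open>The graph of t is coded as a set of reals through an injective pairing, with x repeated
  in every member. The outer singleton only raises the set to the required type.\<close>

lemma inj_into_real_set_set: "\<exists>e :: real \<times> (real \<Rightarrow> real) \<Rightarrow> real set set. inj e"
proof -
  obtain g :: "real \<times> real \<Rightarrow> real" where g: "inj g"
    using real_product_lepoll_real unfolding lepoll_def by blast
  define e :: "real \<times> (real \<Rightarrow> real) \<Rightarrow> real set set"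
    where "e = (\<lambda>(x, t). {range (\<lambda>y. g (x, g (y, t y)))})"
  have "inj e"
  proof (rule injI)
    fix p q :: "real \<times> (real \<Rightarrow> real)" assume "e p = e q"
    moreover obtain x t x' t' where pq: "p = (x, t)" "q = (x', t')"
      by fastforce
    ultimately have eq: "range (\<lambda>y. g (x, g (y, t y))) = range (\<lambda>y. g (x', g (y, t' y)))"
      by (simp add: e_def)
    have "x = x' \<and> t y = t' y" for y
    proof -
      obtain z where "g (x, g (y, t y)) = g (x', g (z, t' z))"
        using eq by (metis (mono_tags, lifting) rangeE rangeI)
      then show ?thesis
        using g by (auto simp: inj_eq)
    qed
    then show "p = q"
      unfolding pq by auto
  qed
  then show ?thesis
    by blast
qed

section \<open>The space, its split-interval image and the map between them\<close>

theorem theorem3p2: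
  shows "(\<exists>K :: real set set topology. good_space K) \<and>
         (\<exists>K :: real set set topology. good_space K \<and>
            (\<exists>K' (L :: real set set topology) f.
                closedin K K' \<and>
                compact_space L \<and> Hausdorff_space L \<and> totally_disconnected_space L \<and>
                \<not> metrizable_space L \<and>
                continuous_map (subtopology K K') L f \<and> f ` K' = topspace L))"
proof -
  obtain A :: "real set" and c :: "real set \<Rightarrow> real" where
    c: "inj_on c perfect_sets" "\<And>P. P \<in> perfect_sets \<Longrightarrow> c P \<in> P - A" and
    A: "A \<subseteq> {0..1}" "uncountable A" "\<And>P. P \<in> perfect_sets \<Longrightarrow> A \<inter> P \<noteq> {}"
    by (rule disjoint_perfect_set_selectors) (rule that)
  have "\<forall>P\<in>perfect_sets. \<exists>f :: real \<Rightarrow> real. continuous_on (- {c P}) f \<and> (\<forall>x. x \<noteq> c P \<longrightarrow> f x \<in> {0..1}) \<and>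
      (\<forall>s\<in>{0..1}. (c P, s) \<in> closure ((\<lambda>x. (x, f x)) ` (P - {c P})))"
  proof
    fix P assume P: "P \<in> perfect_sets"
    then have "c P islimpt P"
      using c(2)[OF P] by (auto simp: perfect_sets_def)
    then obtain f :: "real \<Rightarrow> real" where
      "continuous_on (- {c P}) f" "\<And>x. x \<noteq> c P \<Longrightarrow> f x \<in> {0..1}"
      "\<And>s. s \<in> {0..1} \<Longrightarrow> (c P, s) \<in> closure ((\<lambda>x. (x, f x)) ` (P - {c P}))"
      by (rule oscillating_function) (rule that)
    then show "\<exists>f :: real \<Rightarrow> real. continuous_on (- {c P}) f \<and> (\<forall>x. x \<noteq> c P \<longrightarrow> f x \<in> {0..1}) \<and>
        (\<forall>s\<in>{0..1}. (c P, s) \<in> closure ((\<lambda>x. (x, f x)) ` (P - {c P})))"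
      by (intro exI[of _ f]) simp
  qed
  then obtain f :: "real set \<Rightarrow> real \<Rightarrow> real" where f: "\<forall>P\<in>perfect_sets.
      continuous_on (- {c P}) (f P) \<and> (\<forall>x. x \<noteq> c P \<longrightarrow> f P x \<in> {0..1}) \<and>
      (\<forall>s\<in>{0..1}. (c P, s) \<in> closure ((\<lambda>x. (x, f P x)) ` (P - {c P})))"
    unfolding bchoice_iff by (elim exE)

  \<comment> \<open>\<open>GL\<close> splits the points of \<open>A\<close> and keeps all other
    coordinates at 0. \<open>GK\<close> adds the oscillations at the points \<open>c P\<close>;
    injectivity of \<open>c\<close> recovers \<open>P\<close> from \<open>c P\<close>, and since
    \<open>c P\<close> avoids \<open>A\<close> both families agree on \<open>A\<close>.\<close>
  define GL where "GL y = (if y \<in> A then step_graph y else {0..1} \<times> {0})" for y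
  define GK where "GK y = (if y \<in> c ` perfect_sets
    then osc_graph y (f (inv_into perfect_sets c y)) else GL y)" for y
  have GK_c: "GK (c P) = osc_graph (c P) (f P)" if "P \<in> perfect_sets" for P
    using that c(1) by (simp add: GK_def)
  have GK_A: "GK y = GL y" if "y \<in> A" for y
    using that c(2) by (auto simp: GK_def)
  have GL: "graph_off y (GL y)" for y
    using A(1) by (auto simp: GL_def graph_off_zero intro: graph_off_step_graph)
  have GK: "graph_off y (GK y)" for y
  proof (cases "y \<in> c ` perfect_sets")
    case True
    then obtain P where P: "P \<in> perfect_sets" "y = c P"
      by blast
    then show ?thesis
      unfolding P(2) GK_c[OF P(1)] using bspec[OF f P(1)] by (intro graph_off_osc_graph) auto
  qed (simp add: GK_def GL)
  interpret L: point_resolution GL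
    by unfold_locales (rule GL)
  interpret K: point_resolution GK
    by unfold_locales (rule GK)
  let ?K = "top_of_set (resolution GK)" and ?L = "top_of_set (resolution GL)"

  have "A \<subseteq> {y. (y, 0) \<in> GL y \<and> (y, 1) \<in> GL y}"
    using A(1) by (auto simp: GL_def step_graph_def)
  then have uncL: "uncountable {y. (y, 0) \<in> GL y \<and> (y, 1) \<in> GL y}"
    using A(2) countable_subset by blast
  have "A \<subseteq> {y. (y, 0) \<in> GK y \<and> (y, 1) \<in> GK y}"
    using A(1) by (auto simp: GK_A GL_def step_graph_def)
  then have uncK: "uncountable {y. (y, 0) \<in> GK y \<and> (y, 1) \<in> GK y}"
    using A(2) countable_subset by blast
  have "\<exists>y h. GK y = osc_graph y h \<and> y \<in> {0..1} \<and> (\<forall>x. x \<noteq> y \<longrightarrow> h x \<in> {0..1}) \<and>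
      (\<forall>s\<in>{0..1}. (y, s) \<in> closure ((\<lambda>x. (x, h x)) ` (P - {y})))" if P: "P \<in> perfect_sets" for P
  proof -
    have "c P \<in> {0..1}"
      using c(2)[OF P] P by (auto simp: perfect_sets_def)
    then show ?thesis
      using GK_c[OF P] bspec[OF f P] by (intro exI[of _ "c P"] exI[of _ "f P"]) blast
  qed
  then have goodK: "good_space ?K"
    using uncK by (intro K.good_space_resolution)

  have "\<exists>y\<in>A. a < y \<and> y < b" if "0 \<le> a" "a < b" "b \<le> 1" for a b
  proof -
    \<comment> \<open>The closed middle third is a perfect set, so \<open>A\<close> meets it, and
      the point found lies strictly between \<open>a\<close> and \<open>b\<close>.\<close>
    have "{(2 * a + b) / 3..(a + 2 * b) / 3} \<in> perfect_sets"
      using that by (intro Icc_in_perfect_sets) auto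
    then obtain y where "y \<in> A" "(2 * a + b) / 3 \<le> y" "y \<le> (a + 2 * b) / 3"
      using A(3) by fastforce
    with that show ?thesis
      by (intro bexI[of _ y]) auto
  qed
  then have tdL: "totally_disconnected_space ?L"
    using totally_disconnected_resolution_step_graph unfolding GL_def by blast

  \<comment> \<open>Coordinates outside \<open>A\<close> are replaced by 0, the only value
    \<open>GL\<close> admits there.\<close>
  define r where "r p = (fst p, \<lambda>y. if y \<in> A then snd p y else 0)" for p :: "real \<times> (real \<Rightarrow> real)"
  have "continuous_on (resolution GK) (\<lambda>p. if y \<in> A then snd p y else 0)" for y
    by (cases "y \<in> A") (auto intro: continuous_intros)
  then have cont: "continuous_on (resolution GK) r"
    unfolding r_def by (intro continuous_on_Pair continuous_on_fst continuous_on_id continuous_on_coordinatewise_then_product)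
  have r_image: "r ` resolution GK = resolution GL"
  proof
    show "r ` resolution GK \<subseteq> resolution GL"
    proof (rule image_subsetI)
      fix p assume p: "p \<in> resolution GK"
      then have *: "(fst p, snd p y) \<in> GK y" for y
        by (auto simp: resolution_def)
      then have "fst p \<in> {0..1}"
        using K.G_subset by blast
      with * show "r p \<in> resolution GL"
        unfolding r_def resolution_def using GK_A by (auto simp: GL_def)
    qed
    show "resolution GL \<subseteq> r ` resolution GK"
    proof
      fix p assume "p \<in> resolution GL"
      then have p: "(fst p, snd p y) \<in> GL y" for y
        by (auto simp: resolution_def)
      then have "fst p \<in> {0..1}"
        using L.G_subset by blast
      \<comment> \<open>For surjectivity, any admissible values may fill the coordinates outside
        \<open>A\<close>, as \<open>r\<close> erases them again.\<close>
      then obtain u where u: "\<And>y. (fst p, u y) \<in> GK y"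
        using K.G_total by metis
      define q where "q = (fst p, \<lambda>y. if y \<in> A then snd p y else u y)"
      have "q \<in> resolution GK"
        using p u GK_A by (auto simp: q_def resolution_def)
      moreover have "snd p y = 0" if "y \<notin> A" for y
        using p[of y] that by (auto simp: GL_def)
      then have "r q = p"
        by (auto simp: r_def q_def prod_eq_iff)
      ultimately show "p \<in> r ` resolution GK"
        by blast
    qed
  qed

  obtain e :: "real \<times> (real \<Rightarrow> real) \<Rightarrow> real set set" where e: "inj e"
    using inj_into_real_set_set by blast
  obtain K :: "real set set topology" where K: "?K homeomorphic_space K"
    using homeomorphic_copy_along_injection[OF e] by blast
  obtain L :: "real set set topology" where L: "?L homeomorphic_space L"
    using homeomorphic_copy_along_injection[OF e] by blast
  obtain a where a: "homeomorphic_map K ?K a"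
    using K homeomorphic_space homeomorphic_space_sym by blast
  obtain b where b: "homeomorphic_map ?L L b"
    using L homeomorphic_space by blast
  have "continuous_map ?K ?L r"
    using cont r_image by auto
  then have "continuous_map K L (b \<circ> r \<circ> a)"
    using a b by (meson continuous_map_compose homeomorphic_imp_continuous_map)
  moreover have "(b \<circ> r \<circ> a) ` topspace K = topspace L"
    using homeomorphic_imp_surjective_map[OF a] homeomorphic_imp_surjective_map[OF b] r_image
    by (metis image_comp topspace_euclidean_subtopology)
  moreover have "compact_space L"
    using L.compact_resolution homeomorphic_compact_space[OF L] by (simp add: compact_space_subtopology)
  moreover have "Hausdorff_space L"
    using L.Hausdorff_resolution homeomorphic_Hausdorff_space[OF L] by blast
  moreover have "totally_disconnected_space L"
    using totally_disconnected_space_homeomorphic[OF L tdL] .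
  moreover have "\<not> metrizable_space L"
    using L.not_metrizable_resolution[OF uncL] homeomorphic_metrizable_space[OF L] by blast
  moreover have "good_space K"
    using good_space_homeomorphic[OF K goodK] .
  \<comment> \<open>The same \<open>K\<close> serves both claims, and the closed subspace
    \<open>K'\<close> is all of \<open>K\<close>.\<close>
  ultimately show ?thesis
    by (metis closedin_topspace subtopology_topspace)
qed

end
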